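(* Let $A$ be a Noetherian ring. Every cohereditary $A$-module $X$ is a $\Sigma$-d-Rickart $A$-module.
   Context: Rings are associative with unity and modules are unital right $A$-modules. A module $X$ is cohereditary if every factor module of $X$ is injective. A module $M$ is d-Rickart if $\operatorname{Im}(\phi)$ is a direct summand of $M$ for every $\phi\in\operatorname{End}_A(M)$. A module $X$ is $\Sigma$-d-Rickart if the direct sum $X^{(\Lambda)}$ of $\Lambda$ copies of $X$ is d-Rickart for every non-empty index set $\Lambda$. *)

theory Defs
  imports "HOL-Algebra.Module" "HOL-Algebra.QuotRing"
begin

text \<open>
  The library locale \<open>module\<close> requires a commutative ring of scalars, so right modules over an
  arbitrary unital ring are introduced here, on the library's record type. The library writes
  the scalar on the left: the term \<open>a \<odot>\<^bsub>M\<^esub> x\<close> stands for the right action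
  \<open>x a\<close>, which is why the associativity law below reverses the order of the scalars.
  The ring components \<open>mult\<close> and \<open>one\<close> of the record play no role.
\<close>

locale right_module = R?: ring R + M?: abelian_group M
  for R :: "('a, 'r) ring_scheme" (structure) and M :: "('a, 'b, 'm) module_scheme" (structure) +
  assumes smult_closed [simp, intro]:
      "\<lbrakk>a \<in> carrier R; x \<in> carrier M\<rbrakk> \<Longrightarrow> a \<odot>\<^bsub>M\<^esub> x \<in> carrier M"
    and smult_l_distr:
      "\<lbrakk>a \<in> carrier R; b \<in> carrier R; x \<in> carrier M\<rbrakk> \<Longrightarrow>
       (a \<oplus>\<^bsub>R\<^esub> b) \<odot>\<^bsub>M\<^esub> x = (a \<odot>\<^bsub>M\<^esub> x) \<oplus>\<^bsub>M\<^esub> (b \<odot>\<^bsub>M\<^esub> x)"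
    and smult_r_distr:
      "\<lbrakk>a \<in> carrier R; x \<in> carrier M; y \<in> carrier M\<rbrakk> \<Longrightarrow>
       a \<odot>\<^bsub>M\<^esub> (x \<oplus>\<^bsub>M\<^esub> y) = (a \<odot>\<^bsub>M\<^esub> x) \<oplus>\<^bsub>M\<^esub> (a \<odot>\<^bsub>M\<^esub> y)"
    and smult_assoc:
      "\<lbrakk>a \<in> carrier R; b \<in> carrier R; x \<in> carrier M\<rbrakk> \<Longrightarrow>
       (a \<otimes>\<^bsub>R\<^esub> b) \<odot>\<^bsub>M\<^esub> x = b \<odot>\<^bsub>M\<^esub> (a \<odot>\<^bsub>M\<^esub> x)"
    and smult_one [simp]:
      "x \<in> carrier M \<Longrightarrow> \<one>\<^bsub>R\<^esub> \<odot>\<^bsub>M\<^esub> x = x"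

definition regular_rmodule :: "('a, 'r) ring_scheme \<Rightarrow> ('a, 'a) module" where
  "regular_rmodule R =
     \<lparr>carrier = carrier R, mult = (\<otimes>\<^bsub>R\<^esub>), one = \<one>\<^bsub>R\<^esub>, zero = \<zero>\<^bsub>R\<^esub>, add = (\<oplus>\<^bsub>R\<^esub>),
      smult = (\<lambda>a x. x \<otimes>\<^bsub>R\<^esub> a)\<rparr>"

text \<open>
  Ascending chain condition on right ideals, i.e.\ on submodules of the ring regarded as a right
  module. (The library's \<open>noetherian_ring\<close> speaks about two-sided ideals only, hence is not
  the right notion for noncommutative rings.)
\<close>

definition right_noetherian :: "('a, 'r) ring_scheme \<Rightarrow> bool" where
  "right_noetherian R \<longleftrightarrow>
     (\<forall>I :: nat \<Rightarrow> 'a set.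
        (\<forall>n. submodule (I n) R (regular_rmodule R)) \<and> (\<forall>n. I n \<subseteq> I (Suc n)) \<longrightarrow>
        (\<exists>m. \<forall>n\<ge>m. I n = I m))"

definition rmodule_hom ::
  "('a, 'r) ring_scheme \<Rightarrow> ('a, 'b, 'm) module_scheme \<Rightarrow> ('a, 'c, 'n) module_scheme \<Rightarrow> ('b \<Rightarrow> 'c) set"
  where
  "rmodule_hom R M N =
     {h. h \<in> carrier M \<rightarrow> carrier N \<and>
         (\<forall>x\<in>carrier M. \<forall>y\<in>carrier M. h (x \<oplus>\<^bsub>M\<^esub> y) = h x \<oplus>\<^bsub>N\<^esub> h y) \<and>
         (\<forall>a\<in>carrier R. \<forall>x\<in>carrier M. h (a \<odot>\<^bsub>M\<^esub> x) = a \<odot>\<^bsub>N\<^esub> h x)}"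

text \<open>
  A module is injective if homomorphisms into it extend along monomorphisms. HOL cannot quantify
  over all types, so the test modules have carriers in the sum type \<open>'a + 'e\<close> of the
  ring's and the module's types. This is no restriction: that type contains isomorphic copies of
  the regular module and all its right ideals, so by Baer's criterion extension over these test
  modules is equivalent to extension over the modules of any other type.
\<close>

definition injective_rmodule :: "('a, 'r) ring_scheme \<Rightarrow> ('a, 'e, 'm) module_scheme \<Rightarrow> bool" where
  "injective_rmodule R E \<longleftrightarrow>
     right_module R E \<and>
     (\<forall>(L :: ('a, 'a + 'e) module) (M :: ('a, 'a + 'e) module) f g.
        right_module R L \<and> right_module R M \<and>
        f \<in> rmodule_hom R L M \<and> inj_on f (carrier L) \<and> g \<in> rmodule_hom R L E \<longrightarrow>
        (\<exists>h\<in>rmodule_hom R M E. \<forall>x\<in>carrier L. h (f x) = g x))"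

definition factor_rmodule :: "('a, 'b, 'm) module_scheme \<Rightarrow> 'b set \<Rightarrow> ('a, 'b set) module" where
  "factor_rmodule X N =
     \<lparr>carrier = a_rcosets\<^bsub>X\<^esub> N, mult = undefined, one = undefined,
      zero = N, add = set_add X,
      smult = (\<lambda>a C. \<Union>x\<in>C. N +>\<^bsub>X\<^esub> (a \<odot>\<^bsub>X\<^esub> x))\<rparr>"

definition cohereditary :: "('a, 'r) ring_scheme \<Rightarrow> ('a, 'b, 'm) module_scheme \<Rightarrow> bool" where
  "cohereditary R X \<longleftrightarrow>
     right_module R X \<and>
     (\<forall>N. submodule N R X \<longrightarrow> injective_rmodule R (factor_rmodule X N))"

definition direct_summand ::
  "('a, 'r) ring_scheme \<Rightarrow> ('a, 'b, 'm) module_scheme \<Rightarrow> 'b set \<Rightarrow> bool" where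
  "direct_summand R M N \<longleftrightarrow>
     submodule N R M \<and>
     (\<exists>K. submodule K R M \<and> N \<inter> K = {\<zero>\<^bsub>M\<^esub>} \<and> N <+>\<^bsub>M\<^esub> K = carrier M)"

definition d_Rickart :: "('a, 'r) ring_scheme \<Rightarrow> ('a, 'b, 'm) module_scheme \<Rightarrow> bool" where
  "d_Rickart R M \<longleftrightarrow>
     right_module R M \<and> (\<forall>\<phi>\<in>rmodule_hom R M M. direct_summand R M (\<phi> ` carrier M))"

definition direct_power ::
  "('a, 'b, 'm) module_scheme \<Rightarrow> 'i set \<Rightarrow> ('a, 'i \<Rightarrow> 'b) module" where
  "direct_power X \<Lambda> =
     \<lparr>carrier = {f \<in> \<Lambda> \<rightarrow>\<^sub>E carrier X. finite {i \<in> \<Lambda>. f i \<noteq> \<zero>\<^bsub>X\<^esub>}},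
      mult = undefined, one = undefined,
      zero = (\<lambda>i\<in>\<Lambda>. \<zero>\<^bsub>X\<^esub>),
      add = (\<lambda>f g. \<lambda>i\<in>\<Lambda>. f i \<oplus>\<^bsub>X\<^esub> g i),
      smult = (\<lambda>a f. \<lambda>i\<in>\<Lambda>. a \<odot>\<^bsub>X\<^esub> f i)\<rparr>"

text \<open>
  The type \<open>'i\<close> from which the index sets are drawn has to be a parameter of the definition;
  a theorem concluding \<open>Sigma_d_Rickart TYPE('i) R X\<close> with a free type variable
  \<open>'i\<close> covers index sets of every type.
\<close>

definition Sigma_d_Rickart ::
  "'i itself \<Rightarrow> ('a, 'r) ring_scheme \<Rightarrow> ('a, 'b, 'm) module_scheme \<Rightarrow> bool" where
  "Sigma_d_Rickart _ R X \<longleftrightarrow>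
     right_module R X \<and> (\<forall>\<Lambda> :: 'i set. \<Lambda> \<noteq> {} \<longrightarrow> d_Rickart R (direct_power X \<Lambda>))"


lemma regular_right_module:
  assumes "ring R"
  shows "right_module R (regular_rmodule R)"
proof -
  interpret ring R by fact
  show ?thesis
  proof (intro right_module.intro right_module_axioms.intro)
    show "abelian_group (regular_rmodule R)"
    proof (rule abelian_groupI)
      fix x assume x: "x \<in> carrier (regular_rmodule R)"
      show "\<exists>y\<in>carrier (regular_rmodule R). y \<oplus>\<^bsub>regular_rmodule R\<^esub> x = \<zero>\<^bsub>regular_rmodule R\<^esub>"
        by (rule bexI[of _ "\<ominus>\<^bsub>R\<^esub> x"]) (use x in \<open>auto simp: regular_rmodule_def l_neg\<close>)
    qed (auto simp: regular_rmodule_def a_assoc intro: a_comm)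
  qed (simp_all add: regular_rmodule_def m_assoc l_distr r_distr assms)
qed

lemma (in right_module) smult_zero:
  assumes "a \<in> carrier R" shows "a \<odot>\<^bsub>M\<^esub> \<zero>\<^bsub>M\<^esub> = \<zero>\<^bsub>M\<^esub>"
proof -
  have "a \<odot>\<^bsub>M\<^esub> \<zero>\<^bsub>M\<^esub> \<oplus>\<^bsub>M\<^esub> a \<odot>\<^bsub>M\<^esub> \<zero>\<^bsub>M\<^esub> = a \<odot>\<^bsub>M\<^esub> \<zero>\<^bsub>M\<^esub>"
    using smult_r_distr[OF assms M.zero_closed M.zero_closed] by simp
  then show ?thesis using assms
    by (metis M.add.r_cancel_one' M.zero_closed smult_closed)
qed

lemma (in right_module) factor_smult:
  assumes N: "submodule N R M" and a: "a \<in> carrier R" and x: "x \<in> carrier M"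
  shows "smult (factor_rmodule M N) a (N +>\<^bsub>M\<^esub> x) = N +>\<^bsub>M\<^esub> (a \<odot>\<^bsub>M\<^esub> x)"
proof -
  interpret N: submodule N R M by fact
  have sub: "subgroup N (add_monoid M)" ..
  have eq: "N +>\<^bsub>M\<^esub> (a \<odot>\<^bsub>M\<^esub> y) = N +>\<^bsub>M\<^esub> (a \<odot>\<^bsub>M\<^esub> x)" if "y \<in> N +>\<^bsub>M\<^esub> x" for y
  proof -
    from that obtain n where n: "n \<in> N" "y = n \<oplus>\<^bsub>M\<^esub> x"
      by (auto simp: a_r_coset_def')
    have nM: "n \<in> carrier M" using N.subset n by auto
    have "a \<odot>\<^bsub>M\<^esub> y = a \<odot>\<^bsub>M\<^esub> n \<oplus>\<^bsub>M\<^esub> a \<odot>\<^bsub>M\<^esub> x"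
      using n nM a x smult_r_distr by simp
    then have "a \<odot>\<^bsub>M\<^esub> y \<in> N +>\<^bsub>M\<^esub> (a \<odot>\<^bsub>M\<^esub> x)"
      using N.smult_closed[OF a n(1)] by (auto simp: a_r_coset_def')
    then have "a \<odot>\<^bsub>M\<^esub> y \<in> N #>\<^bsub>add_monoid M\<^esub> (a \<odot>\<^bsub>M\<^esub> x)"
      by (simp only: a_r_coset_def)
    from M.add.repr_independence[OF this _ sub] a x show ?thesis
      unfolding a_r_coset_def by (metis smult_closed)
  qed
  have "x \<in> N +>\<^bsub>M\<^esub> x"
    using M.add.rcos_self[OF x] sub unfolding a_r_coset_def by simp
  then have "(\<Union>y\<in>N +>\<^bsub>M\<^esub> x. N +>\<^bsub>M\<^esub> (a \<odot>\<^bsub>M\<^esub> y)) = N +>\<^bsub>M\<^esub> (a \<odot>\<^bsub>M\<^esub> x)"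
    using eq by blast
  then show ?thesis by (simp only: factor_rmodule_def module.simps)
qed

lemma (in right_module) factor_right_module:
  assumes N: "submodule N R M"
  shows "right_module R (factor_rmodule M N)"
proof -
  interpret N: submodule N R M by fact
  have sub: "subgroup N (add_monoid M)" ..
  interpret NN: normal N "add_monoid M"
    using M.a_comm_group sub by (simp add: comm_group.subgroup_imp_normal)
  let ?F = "factor_rmodule M N"
  have car: "carrier ?F = (\<lambda>x. N +>\<^bsub>M\<^esub> x) ` carrier M"
    by (auto simp: factor_rmodule_def A_RCOSETS_def')
  have add: "(N +>\<^bsub>M\<^esub> x) \<oplus>\<^bsub>?F\<^esub> (N +>\<^bsub>M\<^esub> y) = N +>\<^bsub>M\<^esub> (x \<oplus>\<^bsub>M\<^esub> y)"
    if "x \<in> carrier M" "y \<in> carrier M" for x y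
    using NN.rcos_sum that unfolding factor_rmodule_def set_add_def a_r_coset_def by simp
  have zero: "\<zero>\<^bsub>?F\<^esub> = N +>\<^bsub>M\<^esub> \<zero>\<^bsub>M\<^esub>"
    using M.add.coset_mult_one[of N] N.subset unfolding factor_rmodule_def a_r_coset_def by simp
  show ?thesis
  proof (intro right_module.intro right_module_axioms.intro)
    show "ring R" by (rule R.ring_axioms)
    show "abelian_group ?F"
    proof (rule abelian_groupI)
      fix x assume "x \<in> carrier ?F"
      then obtain u where u: "u \<in> carrier M" "x = N +>\<^bsub>M\<^esub> u" by (auto simp: car)
      show "\<exists>y\<in>carrier ?F. y \<oplus>\<^bsub>?F\<^esub> x = \<zero>\<^bsub>?F\<^esub>"
        by (rule bexI[of _ "N +>\<^bsub>M\<^esub> (\<ominus>\<^bsub>M\<^esub> u)"]) (use u in \<open>auto simp: add zero M.l_neg car\<close>)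
    next
      fix x y z assume "x \<in> carrier ?F" "y \<in> carrier ?F" "z \<in> carrier ?F"
      then show "(x \<oplus>\<^bsub>?F\<^esub> y) \<oplus>\<^bsub>?F\<^esub> z = x \<oplus>\<^bsub>?F\<^esub> (y \<oplus>\<^bsub>?F\<^esub> z)"
        unfolding car by (elim imageE) (simp add: add M.a_assoc)
    next
      fix x y assume "x \<in> carrier ?F" "y \<in> carrier ?F"
      then show "x \<oplus>\<^bsub>?F\<^esub> y = y \<oplus>\<^bsub>?F\<^esub> x"
        unfolding car by (elim imageE) (simp add: add M.a_comm)
    qed (auto simp: car add zero)
  qed (auto simp: car add factor_smult[OF N] smult_l_distr smult_r_distr smult_assoc)
qed

lemma (in right_module) direct_power_right_module:
  "right_module R (direct_power M \<Lambda>)"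
proof -
  let ?D = "direct_power M \<Lambda>"
  have carI: "restrict f \<Lambda> \<in> carrier ?D"
    if "\<And>i. i \<in> \<Lambda> \<Longrightarrow> f i \<in> carrier M" "finite S" "\<And>i. i \<in> \<Lambda> - S \<Longrightarrow> f i = \<zero>\<^bsub>M\<^esub>" for f S
    using that by (auto simp: direct_power_def intro: finite_subset[of _ S])
  have val: "f i \<in> carrier M" if "f \<in> carrier ?D" "i \<in> \<Lambda>" for f i
    using that by (auto simp: direct_power_def)
  have fin: "finite {i \<in> \<Lambda>. f i \<noteq> \<zero>\<^bsub>M\<^esub>}" if "f \<in> carrier ?D" for f
    using that by (auto simp: direct_power_def)
  have ext: "f = g" if "f \<in> carrier ?D" "g \<in> carrier ?D" "\<And>i. i \<in> \<Lambda> \<Longrightarrow> f i = g i" for f g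
    using that by (auto simp: direct_power_def intro: PiE_ext)
  have add_val: "(f \<oplus>\<^bsub>?D\<^esub> g) i = f i \<oplus>\<^bsub>M\<^esub> g i" if "i \<in> \<Lambda>" for f g i
    using that by (simp add: direct_power_def)
  have zero_val: "\<zero>\<^bsub>?D\<^esub> i = \<zero>\<^bsub>M\<^esub>" if "i \<in> \<Lambda>" for i
    using that by (simp add: direct_power_def)
  have smult_val: "(a \<odot>\<^bsub>?D\<^esub> f) i = a \<odot>\<^bsub>M\<^esub> f i" if "i \<in> \<Lambda>" for a f i
    using that by (simp add: direct_power_def)
  have add_cl: "f \<oplus>\<^bsub>?D\<^esub> g \<in> carrier ?D" if f: "f \<in> carrier ?D" and g: "g \<in> carrier ?D" for f g
  proof -
    have "(\<lambda>i\<in>\<Lambda>. f i \<oplus>\<^bsub>M\<^esub> g i) \<in> carrier ?D"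
      by (rule carI[OF _ finite_UnI[OF fin[OF f] fin[OF g]]]) (use val f g in auto)
    then show ?thesis by (simp add: direct_power_def)
  qed
  have zero_cl: "\<zero>\<^bsub>?D\<^esub> \<in> carrier ?D"
    by (simp add: direct_power_def)
  have smult_cl: "a \<odot>\<^bsub>?D\<^esub> f \<in> carrier ?D" if a: "a \<in> carrier R" and f: "f \<in> carrier ?D" for a f
  proof -
    have "(\<lambda>i\<in>\<Lambda>. a \<odot>\<^bsub>M\<^esub> f i) \<in> carrier ?D"
      by (rule carI[OF _ fin[OF f]]) (use val f a smult_zero in auto)
    then show ?thesis by (simp add: direct_power_def)
  qed
  show ?thesis
  proof (intro right_module.intro right_module_axioms.intro)
    show "ring R" by (rule R.ring_axioms)
    show "abelian_group ?D"
    proof (rule abelian_groupI)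
      fix f assume f: "f \<in> carrier ?D"
      have cl: "(\<lambda>i\<in>\<Lambda>. \<ominus>\<^bsub>M\<^esub> f i) \<in> carrier ?D"
        by (rule carI[OF _ fin[OF f]]) (use val f in auto)
      show "\<exists>g\<in>carrier ?D. g \<oplus>\<^bsub>?D\<^esub> f = \<zero>\<^bsub>?D\<^esub>"
        by (rule bexI[OF _ cl], rule ext)
          (use add_cl zero_cl cl f val in \<open>auto simp: add_val zero_val M.l_neg\<close>)
    qed (auto simp: add_cl zero_cl add_val zero_val val M.a_ac intro!: ext)
  qed (auto simp: add_cl smult_cl add_val smult_val val smult_l_distr smult_r_distr smult_assoc
      intro!: ext)
qed

end

theory Submission
  imports Defs
begin

text \<open>
  Write \<open>D\<close> for the direct power. The image of an endomorphism \<open>\<phi>\<close> of \<open>D\<close> is the directed union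
  of the images of the finite subpowers, and each of these is a finite sum of images of \<open>X\<close>.
  Injectivity enters only through Baer's condition: every homomorphism from a right ideal is given
  by the action on a fixed element. It holds for images of the cohereditary module \<open>X\<close>. It passes
  from \<open>E\<close> to \<open>E + \<psi> X\<close>: modulo \<open>E\<close> the given homomorphism takes values in an image of \<open>X\<close>,
  hence is \<open>a \<mapsto> (\<psi> x) a\<close> for some \<open>x\<close>, and the difference takes values in \<open>E\<close>. Over a
  right Noetherian ring it passes to directed unions, so it holds for the image of \<open>\<phi>\<close>. Finally, a
  submodule satisfying Baer's condition is a direct summand.
\<close>

section \<open>Submodules and subtraction in right modules\<close>

text \<open>The negative of \<open>x\<close> is \<open>x\<close> acted on by minus one, so closure
  under addition and scalars already yields the additive subgroup that \<open>submodule\<close> asks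
  for.\<close>

lemma (in right_module) r_submoduleI:
  assumes subset: "H \<subseteq> carrier M" and zero: "\<zero>\<^bsub>M\<^esub> \<in> H"
    and add: "\<And>x y. \<lbrakk>x \<in> H; y \<in> H\<rbrakk> \<Longrightarrow> x \<oplus>\<^bsub>M\<^esub> y \<in> H"
    and smult: "\<And>a x. \<lbrakk>a \<in> carrier R; x \<in> H\<rbrakk> \<Longrightarrow> a \<odot>\<^bsub>M\<^esub> x \<in> H"
  shows "submodule H R M"
proof -
  have inv: "\<ominus>\<^bsub>M\<^esub> x \<in> H" if "x \<in> H" for x
  proof -
    have x: "x \<in> carrier M" using that subset by auto
    have "(\<ominus>\<^bsub>R\<^esub> \<one>\<^bsub>R\<^esub>) \<odot>\<^bsub>M\<^esub> x \<oplus>\<^bsub>M\<^esub> x = (\<ominus>\<^bsub>R\<^esub> \<one>\<^bsub>R\<^esub> \<oplus>\<^bsub>R\<^esub> \<one>\<^bsub>R\<^esub>) \<odot>\<^bsub>M\<^esub> x"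
      using x by (simp add: smult_l_distr)
    also have "\<dots> = \<zero>\<^bsub>R\<^esub> \<odot>\<^bsub>M\<^esub> x" by (simp add: R.l_neg)
    also have "\<dots> = \<zero>\<^bsub>M\<^esub>"
      using smult_l_distr[OF R.zero_closed R.zero_closed x] x
      by (metis M.add.r_cancel_one' R.l_zero R.zero_closed smult_closed)
    finally have "\<ominus>\<^bsub>M\<^esub> x = (\<ominus>\<^bsub>R\<^esub> \<one>\<^bsub>R\<^esub>) \<odot>\<^bsub>M\<^esub> x"
      using x by (intro M.minus_equality) auto
    then show ?thesis using smult that by simp
  qed
  show ?thesis
    using assms inv unfolding submodule_def submodule_axioms_def a_inv_def
    by (auto intro!: subgroup.intro)
qed

lemma (in right_module) r_submoduleE:
  assumes "submodule H R M"
  shows "H \<subseteq> carrier M" "\<zero>\<^bsub>M\<^esub> \<in> H"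
    "\<And>x y. \<lbrakk>x \<in> H; y \<in> H\<rbrakk> \<Longrightarrow> x \<oplus>\<^bsub>M\<^esub> y \<in> H"
    "\<And>x. x \<in> H \<Longrightarrow> \<ominus>\<^bsub>M\<^esub> x \<in> H"
    "\<And>x y. \<lbrakk>x \<in> H; y \<in> H\<rbrakk> \<Longrightarrow> x \<ominus>\<^bsub>M\<^esub> y \<in> H"
    "\<And>a x. \<lbrakk>a \<in> carrier R; x \<in> H\<rbrakk> \<Longrightarrow> a \<odot>\<^bsub>M\<^esub> x \<in> H"
proof -
  interpret H: submodule H R M by fact
  show "H \<subseteq> carrier M" by (rule H.subset[simplified])
  show "\<zero>\<^bsub>M\<^esub> \<in> H" using H.one_closed by simp
  show add: "x \<oplus>\<^bsub>M\<^esub> y \<in> H" if "x \<in> H" "y \<in> H" for x y using H.m_closed that by simp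
  show inv: "\<ominus>\<^bsub>M\<^esub> x \<in> H" if "x \<in> H" for x using H.m_inv_closed that by (simp add: a_inv_def)
  show "x \<ominus>\<^bsub>M\<^esub> y \<in> H" if "x \<in> H" "y \<in> H" for x y using add inv that by (simp add: a_minus_def)
  show "a \<odot>\<^bsub>M\<^esub> x \<in> H" if "a \<in> carrier R" "x \<in> H" for a x using H.smult_closed that by simp
qed

lemma (in right_module) smult_minus:
  assumes "a \<in> carrier R" "x \<in> carrier M" "y \<in> carrier M"
  shows "a \<odot>\<^bsub>M\<^esub> (x \<ominus>\<^bsub>M\<^esub> y) = a \<odot>\<^bsub>M\<^esub> x \<ominus>\<^bsub>M\<^esub> a \<odot>\<^bsub>M\<^esub> y"
proof -
  have "a \<odot>\<^bsub>M\<^esub> (\<ominus>\<^bsub>M\<^esub> y) \<oplus>\<^bsub>M\<^esub> a \<odot>\<^bsub>M\<^esub> y = \<zero>\<^bsub>M\<^esub>"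
    using assms smult_r_distr[of a "\<ominus>\<^bsub>M\<^esub> y" y] by (simp add: M.l_neg smult_zero)
  then have "\<ominus>\<^bsub>M\<^esub> (a \<odot>\<^bsub>M\<^esub> y) = a \<odot>\<^bsub>M\<^esub> (\<ominus>\<^bsub>M\<^esub> y)"
    using assms by (intro M.minus_equality) auto
  then show ?thesis using assms by (simp add: a_minus_def smult_r_distr)
qed

lemma (in right_module) diff_eq_zero_iff:
  assumes "x \<in> carrier M" "y \<in> carrier M"
  shows "x \<ominus>\<^bsub>M\<^esub> y = \<zero>\<^bsub>M\<^esub> \<longleftrightarrow> x = y"
proof
  assume "x \<ominus>\<^bsub>M\<^esub> y = \<zero>\<^bsub>M\<^esub>"
  moreover have "x = (x \<ominus>\<^bsub>M\<^esub> y) \<oplus>\<^bsub>M\<^esub> y"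
    using assms by (simp add: a_minus_def M.a_assoc M.l_neg)
  ultimately show "x = y" using assms by simp
qed (use assms in \<open>simp add: a_minus_def M.r_neg\<close>)

lemma (in right_module) add_diff_add:
  assumes "x \<in> carrier M" "y \<in> carrier M" "u \<in> carrier M" "v \<in> carrier M"
  shows "(x \<oplus>\<^bsub>M\<^esub> y) \<ominus>\<^bsub>M\<^esub> (u \<oplus>\<^bsub>M\<^esub> v) = (x \<ominus>\<^bsub>M\<^esub> u) \<oplus>\<^bsub>M\<^esub> (y \<ominus>\<^bsub>M\<^esub> v)"
  using assms by (simp add: a_minus_def M.minus_add M.a_ac)

lemma (in right_module) diff_add_cancel:
  assumes "x \<in> carrier M" "y \<in> carrier M"
  shows "(x \<ominus>\<^bsub>M\<^esub> y) \<oplus>\<^bsub>M\<^esub> y = x"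
  using assms by (simp add: a_minus_def M.a_assoc M.l_neg)

lemma (in right_module) add_diff_cancel_left:
  assumes "x \<in> carrier M" "y \<in> carrier M"
  shows "(x \<oplus>\<^bsub>M\<^esub> y) \<ominus>\<^bsub>M\<^esub> x = y"
  using assms by (simp add: M.a_comm[of x y] a_minus_def M.a_assoc M.r_neg)

text \<open>Serves to compare the remainders that two candidates for a component leave of the same
  element \<open>x\<close>.\<close>

lemma (in right_module) diff_diff_diff:
  assumes "x \<in> carrier M" "y \<in> carrier M" "z \<in> carrier M"
  shows "(x \<ominus>\<^bsub>M\<^esub> y) \<ominus>\<^bsub>M\<^esub> (x \<ominus>\<^bsub>M\<^esub> z) = z \<ominus>\<^bsub>M\<^esub> y"
  using add_diff_add[of x "\<ominus>\<^bsub>M\<^esub> y" x "\<ominus>\<^bsub>M\<^esub> z"] assms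
  by (simp add: a_minus_def M.r_neg M.a_comm[of "\<ominus>\<^bsub>M\<^esub> y" z])

lemma (in right_module) submodule_right_module:
  assumes "submodule H R M"
  shows "right_module R (M\<lparr>carrier := H\<rparr>)"
proof (intro right_module.intro right_module_axioms.intro R.ring_axioms abelian_groupI)
  note H = r_submoduleE[OF assms]
  fix x assume "x \<in> carrier (M\<lparr>carrier := H\<rparr>)"
  then show "\<exists>y\<in>carrier (M\<lparr>carrier := H\<rparr>). y \<oplus>\<^bsub>M\<lparr>carrier := H\<rparr>\<^esub> x = \<zero>\<^bsub>M\<lparr>carrier := H\<rparr>\<^esub>"
    using H by (auto intro!: bexI[of _ "\<ominus>\<^bsub>M\<^esub> x"] simp: subset_iff M.l_neg)
qed (use r_submoduleE[OF assms] in
    \<open>auto simp: M.a_assoc smult_l_distr smult_r_distr smult_assoc subset_iff intro: M.a_comm\<close>)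

text \<open>Moves ideals of the ring into the type of the test modules of \<open>injective_rmodule\<close>.\<close>

definition inl_rmodule :: "('a, 'b, 'm) module_scheme \<Rightarrow> ('a, 'b + 'c) module" where
  "inl_rmodule M =
     \<lparr>carrier = Inl ` carrier M, mult = undefined, one = undefined,
      zero = Inl \<zero>\<^bsub>M\<^esub>, add = (\<lambda>x y. Inl (projl x \<oplus>\<^bsub>M\<^esub> projl y)),
      smult = (\<lambda>a x. Inl (a \<odot>\<^bsub>M\<^esub> projl x))\<rparr>"

lemma inl_right_module:
  assumes "right_module R M"
  shows "right_module R (inl_rmodule M)"
proof -
  interpret right_module R M by fact
  show ?thesis
  proof (intro right_module.intro right_module_axioms.intro R.ring_axioms abelian_groupI)
    fix x assume "x \<in> carrier (inl_rmodule M)"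
    then show "\<exists>y\<in>carrier (inl_rmodule M). y \<oplus>\<^bsub>inl_rmodule M\<^esub> x = \<zero>\<^bsub>inl_rmodule M\<^esub>"
      by (auto simp: inl_rmodule_def M.l_neg intro!: bexI[of _ "\<ominus>\<^bsub>M\<^esub> (projl x)"])
  qed (auto simp: inl_rmodule_def M.a_assoc smult_l_distr smult_r_distr smult_assoc intro: M.a_comm)
qed

section \<open>Homomorphisms, images and preimages\<close>

lemma rmodule_homD:
  assumes "h \<in> rmodule_hom R M N"
  shows "\<And>x. x \<in> carrier M \<Longrightarrow> h x \<in> carrier N"
    "\<And>x y. \<lbrakk>x \<in> carrier M; y \<in> carrier M\<rbrakk> \<Longrightarrow> h (x \<oplus>\<^bsub>M\<^esub> y) = h x \<oplus>\<^bsub>N\<^esub> h y"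
    "\<And>a x. \<lbrakk>a \<in> carrier R; x \<in> carrier M\<rbrakk> \<Longrightarrow> h (a \<odot>\<^bsub>M\<^esub> x) = a \<odot>\<^bsub>N\<^esub> h x"
  using assms by (auto simp: rmodule_hom_def)

lemma rmodule_hom_zero:
  assumes "right_module R M" "right_module R N" "h \<in> rmodule_hom R M N"
  shows "h \<zero>\<^bsub>M\<^esub> = \<zero>\<^bsub>N\<^esub>"
proof -
  interpret M: right_module R M by fact
  interpret N: right_module R N by fact
  have "h \<zero>\<^bsub>M\<^esub> \<oplus>\<^bsub>N\<^esub> h \<zero>\<^bsub>M\<^esub> = h \<zero>\<^bsub>M\<^esub>"
    using rmodule_homD(2)[OF assms(3), of "\<zero>\<^bsub>M\<^esub>" "\<zero>\<^bsub>M\<^esub>"] by simp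
  then show ?thesis
    by (metis M.M.zero_closed N.M.add.r_cancel_one' assms(3) rmodule_homD(1))
qed

lemma rmodule_hom_image_submodule:
  assumes "right_module R M" "right_module R N" "h \<in> rmodule_hom R M N" "submodule H R M"
  shows "submodule (h ` H) R N"
proof -
  interpret M: right_module R M by fact
  interpret N: right_module R N by fact
  note h = rmodule_homD[OF assms(3)] and H = M.r_submoduleE[OF assms(4)]
  show ?thesis
  proof (rule N.r_submoduleI)
    show "\<zero>\<^bsub>N\<^esub> \<in> h ` H" using rmodule_hom_zero[OF assms(1-3)] H(2) by (metis imageI)
    show "x \<oplus>\<^bsub>N\<^esub> y \<in> h ` H" if "x \<in> h ` H" "y \<in> h ` H" for x y
      using that H(1,3) h(2) by (auto simp: subset_iff) (metis imageI)
    show "a \<odot>\<^bsub>N\<^esub> x \<in> h ` H" if "a \<in> carrier R" "x \<in> h ` H" for a x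
      using that H(1,6) h(3) by (auto simp: subset_iff) (metis imageI)
  qed (use H(1) h(1) in auto)
qed

text \<open>Applied to the zero submodule it gives kernels; applied to a map sending
  \<open>a\<close> to \<open>d a\<close> it gives right ideals.\<close>

lemma rmodule_hom_vimage_submodule:
  assumes "right_module R M" "right_module R N" "h \<in> rmodule_hom R M N" "submodule H R N"
  shows "submodule {x \<in> carrier M. h x \<in> H} R M"
proof -
  interpret M: right_module R M by fact
  interpret N: right_module R N by fact
  note h = rmodule_homD[OF assms(3)] and H = N.r_submoduleE[OF assms(4)]
  show ?thesis
    by (rule M.r_submoduleI) (use h H rmodule_hom_zero[OF assms(1-3)] in auto)
qed

section \<open>Baer's condition\<close>

text \<open>A homomorphism from the regular module is determined by its value \<open>e\<close> at 1,
  so the existence of \<open>e\<close> says that \<open>h\<close> extends from \<open>J\<close> to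
  the whole ring. In this form the test objects are sets in the type of the ring, whatever the type
  of \<open>E\<close>.\<close>

definition baer_injective :: "('a, 'r) ring_scheme \<Rightarrow> ('a, 'b, 'm) module_scheme \<Rightarrow> bool" where
  "baer_injective R E \<longleftrightarrow>
     (\<forall>J h. submodule J R (regular_rmodule R) \<and>
        h \<in> rmodule_hom R (regular_rmodule R\<lparr>carrier := J\<rparr>) E \<longrightarrow>
        (\<exists>e\<in>carrier E. \<forall>a\<in>J. h a = a \<odot>\<^bsub>E\<^esub> e))"

lemma baer_injectiveD:
  assumes "baer_injective R E" "submodule J R (regular_rmodule R)"
    "h \<in> rmodule_hom R (regular_rmodule R\<lparr>carrier := J\<rparr>) E"
  obtains e where "e \<in> carrier E" "\<And>a. a \<in> J \<Longrightarrow> h a = a \<odot>\<^bsub>E\<^esub> e"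
  using assms unfolding baer_injective_def by blast

text \<open>Injectivity is tested on the inclusion of \<open>J\<close> into the ring; the value of
  the extension at 1 is the required element.\<close>

lemma injective_imp_baer_injective:
  fixes E :: "('a, 'e, 'm) module_scheme"
  assumes "injective_rmodule R E"
  shows "baer_injective R E"
  unfolding baer_injective_def
proof (intro allI impI, elim conjE)
  fix J h
  assume J: "submodule J R (regular_rmodule R)"
    and h: "h \<in> rmodule_hom R (regular_rmodule R\<lparr>carrier := J\<rparr>) E"
  interpret E: right_module R E using assms by (simp add: injective_rmodule_def)
  interpret reg: right_module R "regular_rmodule R"
    by (rule regular_right_module[OF E.R.ring_axioms])
  let ?L = "inl_rmodule (regular_rmodule R\<lparr>carrier := J\<rparr>) :: ('a, 'a + 'e) module"
  let ?M = "inl_rmodule (regular_rmodule R) :: ('a, 'a + 'e) module"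
  have JR: "J \<subseteq> carrier R"
    using reg.r_submoduleE(1)[OF J] by (simp add: regular_rmodule_def)
  have L: "right_module R ?L" and M: "right_module R ?M"
    by (auto intro: inl_right_module reg.submodule_right_module[OF J] reg.right_module_axioms)
  \<comment> \<open>Both test modules are copies under \<open>Inl\<close> with the same operations,
    so the inclusion is literally the identity.\<close>
  have f: "id \<in> rmodule_hom R ?L ?M"
    using JR by (auto simp: rmodule_hom_def inl_rmodule_def regular_rmodule_def)
  have g: "h \<circ> projl \<in> rmodule_hom R ?L E"
    using h by (auto simp: rmodule_hom_def inl_rmodule_def)
  obtain k where k: "k \<in> rmodule_hom R ?M E" "\<forall>x\<in>carrier ?L. k (id x) = (h \<circ> projl) x"
    using assms L M f g unfolding injective_rmodule_def by (meson inj_on_id)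
  have "h a = a \<odot>\<^bsub>E\<^esub> k (Inl \<one>\<^bsub>R\<^esub>)" if a: "a \<in> J" for a
  proof -
    have "h a = k (Inl a)" using k(2) a by (simp add: inl_rmodule_def)
    \<comment> \<open>In the regular module \<open>a\<close> acts by multiplication on the right, so
      \<open>a\<close> acting on 1 is \<open>a\<close> itself.\<close>
    also have "\<dots> = k (a \<odot>\<^bsub>?M\<^esub> Inl \<one>\<^bsub>R\<^esub>)"
      using a JR by (auto simp: inl_rmodule_def regular_rmodule_def)
    also have "\<dots> = a \<odot>\<^bsub>E\<^esub> k (Inl \<one>\<^bsub>R\<^esub>)"
      by (rule rmodule_homD(3)[OF k(1)])
        (use a JR in \<open>auto simp: inl_rmodule_def regular_rmodule_def\<close>)
    finally show ?thesis .
  qed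
  moreover have "k (Inl \<one>\<^bsub>R\<^esub>) \<in> carrier E"
    by (rule rmodule_homD(1)[OF k(1)]) (auto simp: inl_rmodule_def regular_rmodule_def)
  ultimately show "\<exists>e\<in>carrier E. \<forall>a\<in>J. h a = a \<odot>\<^bsub>E\<^esub> e" by blast
qed

section \<open>Cosets in factor modules\<close>

lemma (in right_module) factor_carrier:
  "carrier (factor_rmodule M N) = (\<lambda>x. N +>\<^bsub>M\<^esub> x) ` carrier M"
  by (auto simp: factor_rmodule_def A_RCOSETS_def')

lemma (in right_module) factor_add:
  assumes "submodule N R M" "x \<in> carrier M" "y \<in> carrier M"
  shows "(N +>\<^bsub>M\<^esub> x) \<oplus>\<^bsub>factor_rmodule M N\<^esub> (N +>\<^bsub>M\<^esub> y) = N +>\<^bsub>M\<^esub> (x \<oplus>\<^bsub>M\<^esub> y)"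
proof -
  interpret N: submodule N R M by fact
  have "subgroup N (add_monoid M)" ..
  then interpret NN: normal N "add_monoid M"
    using M.a_comm_group by (simp add: comm_group.subgroup_imp_normal)
  show ?thesis
    using NN.rcos_sum assms(2,3) unfolding factor_rmodule_def set_add_def a_r_coset_def by simp
qed

lemma (in right_module) coset_eq_iff:
  assumes "submodule N R M" "x \<in> carrier M" "y \<in> carrier M"
  shows "N +>\<^bsub>M\<^esub> x = N +>\<^bsub>M\<^esub> y \<longleftrightarrow> x \<ominus>\<^bsub>M\<^esub> y \<in> N"
proof
  note N = r_submoduleE[OF assms(1)]
  interpret N: submodule N R M by fact
  have sub: "subgroup N (add_monoid M)" ..
  {
    assume "N +>\<^bsub>M\<^esub> x = N +>\<^bsub>M\<^esub> y"
    then have "x \<in> N +>\<^bsub>M\<^esub> y"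
      using M.add.rcos_self[OF assms(2) sub] by (simp add: a_r_coset_def)
    then obtain n where n: "n \<in> N" "x = n \<oplus>\<^bsub>M\<^esub> y" by (auto simp: a_r_coset_def')
    then have "x \<ominus>\<^bsub>M\<^esub> y = n"
      using assms(3) N(1) by (auto simp: a_minus_def M.a_assoc M.r_neg subset_iff)
    then show "x \<ominus>\<^bsub>M\<^esub> y \<in> N" using n by simp
  next
    assume d: "x \<ominus>\<^bsub>M\<^esub> y \<in> N"
    have "x = (x \<ominus>\<^bsub>M\<^esub> y) \<oplus>\<^bsub>M\<^esub> y"
      using assms by (simp add: a_minus_def M.a_assoc M.l_neg)
    then have "x \<in> N +>\<^bsub>M\<^esub> y" using d by (auto simp: a_r_coset_def')
    then show "N +>\<^bsub>M\<^esub> x = N +>\<^bsub>M\<^esub> y"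
      using M.add.repr_independence[of x N y] sub assms(3) by (simp add: a_r_coset_def)
  }
qed

lemma rmodule_hom_minus:
  assumes "right_module R M" "right_module R N" "h \<in> rmodule_hom R M N"
    "x \<in> carrier M" "y \<in> carrier M"
  shows "h (x \<ominus>\<^bsub>M\<^esub> y) = h x \<ominus>\<^bsub>N\<^esub> h y"
proof -
  interpret M: right_module R M by fact
  interpret N: right_module R N by fact
  note h = rmodule_homD[OF assms(3)]
  have "h (x \<ominus>\<^bsub>M\<^esub> y) \<oplus>\<^bsub>N\<^esub> h y = h ((x \<ominus>\<^bsub>M\<^esub> y) \<oplus>\<^bsub>M\<^esub> y)"
    using assms(4,5) h(2) by simp
  also have "(x \<ominus>\<^bsub>M\<^esub> y) \<oplus>\<^bsub>M\<^esub> y = x"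
    using assms(4,5) by (simp add: a_minus_def M.M.a_assoc M.M.l_neg)
  finally have "h x = h (x \<ominus>\<^bsub>M\<^esub> y) \<oplus>\<^bsub>N\<^esub> h y" by simp
  then show ?thesis
    using assms(4,5) h(1) by (simp add: a_minus_def N.M.a_assoc N.M.r_neg)
qed

section \<open>Baer's condition for images, sums and directed unions\<close>

text \<open>The image is isomorphic to the factor of \<open>X\<close> by the kernel
  \<open>K\<close>, which is injective by hypothesis. Instead of building the isomorphism, the proof
  lifts \<open>h\<close> to cosets of \<open>K\<close> and maps the resulting element back by
  \<open>\<psi>\<close>.\<close>

lemma cohereditary_image_baer_injective:
  assumes coh: "cohereditary R X" and D: "right_module R D" and psi: "\<psi> \<in> rmodule_hom R X D"
  shows "baer_injective R (D\<lparr>carrier := \<psi> ` carrier X\<rparr>)"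
  unfolding baer_injective_def
proof (intro allI impI, elim conjE)
  fix J h
  assume J: "submodule J R (regular_rmodule R)"
    and h: "h \<in> rmodule_hom R (regular_rmodule R\<lparr>carrier := J\<rparr>) (D\<lparr>carrier := \<psi> ` carrier X\<rparr>)"
  interpret X: right_module R X using coh by (simp add: cohereditary_def)
  interpret D: right_module R D by fact
  note p = rmodule_homD[OF psi]
  \<comment> \<open>The kernel, written as a preimage so that
    \<open>rmodule_hom_vimage_submodule\<close> applies.\<close>
  define K where "K = {x \<in> carrier X. \<psi> x \<in> {\<zero>\<^bsub>D\<^esub>}}"
  have "submodule {\<zero>\<^bsub>D\<^esub>} R D" by (rule D.r_submoduleI) (auto simp: D.smult_zero)
  then have K: "submodule K R X"
    unfolding K_def by (rule rmodule_hom_vimage_submodule[OF X.right_module_axioms D psi])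
  have coset: "K +>\<^bsub>X\<^esub> x = K +>\<^bsub>X\<^esub> y \<longleftrightarrow> \<psi> x = \<psi> y"
    if "x \<in> carrier X" "y \<in> carrier X" for x y
  proof -
    have "x \<ominus>\<^bsub>X\<^esub> y \<in> K \<longleftrightarrow> \<psi> x = \<psi> y"
      using that p(1)
      by (simp add: K_def D.diff_eq_zero_iff rmodule_hom_minus[OF X.right_module_axioms D psi])
    then show ?thesis using X.coset_eq_iff[OF K that] by simp
  qed
  have baer: "baer_injective R (factor_rmodule X K)"
    using coh K by (simp add: cohereditary_def injective_imp_baer_injective)
  \<comment> \<open>An arbitrary preimage of \<open>h a\<close> in \<open>X\<close>. The map
    \<open>s\<close> itself need not be additive; only its coset modulo \<open>K\<close> is
    determined by \<open>h a\<close>.\<close>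
  define s where "s a = inv_into (carrier X) \<psi> (h a)" for a
  have s: "s a \<in> carrier X" "\<psi> (s a) = h a" if "a \<in> J" for a
    using rmodule_homD(1)[OF h] that unfolding s_def by (auto intro: inv_into_into f_inv_into_f)
  note reg = X.R.ring_axioms[THEN regular_right_module]
  have J_cl: "\<And>x y. \<lbrakk>x \<in> J; y \<in> J\<rbrakk> \<Longrightarrow> x \<oplus>\<^bsub>R\<^esub> y \<in> J"
    "\<And>a x. \<lbrakk>a \<in> carrier R; x \<in> J\<rbrakk> \<Longrightarrow> x \<otimes>\<^bsub>R\<^esub> a \<in> J" "J \<subseteq> carrier R"
    using right_module.r_submoduleE[OF reg J] by (auto simp: regular_rmodule_def)
  \<comment> \<open>Linearity holds because \<open>coset\<close> reduces equations between cosets to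
    equations between values of \<open>\<psi>\<close>, and \<open>\<psi>\<close> takes
    \<open>s a\<close> to \<open>h a\<close>.\<close>
  have "(\<lambda>a. K +>\<^bsub>X\<^esub> s a) \<in>
    rmodule_hom R (regular_rmodule R\<lparr>carrier := J\<rparr>) (factor_rmodule X K)"
    using s J_cl rmodule_homD(2,3)[OF h] p(2,3)
    by (auto simp: rmodule_hom_def X.factor_carrier X.factor_add[OF K] X.factor_smult[OF K]
        coset regular_rmodule_def)
  then obtain e where e: "e \<in> carrier (factor_rmodule X K)"
    "\<And>a. a \<in> J \<Longrightarrow> K +>\<^bsub>X\<^esub> s a = a \<odot>\<^bsub>factor_rmodule X K\<^esub> e"
    using baer_injectiveD[OF baer J] by blast
  then obtain x where x: "x \<in> carrier X" "e = K +>\<^bsub>X\<^esub> x" by (auto simp: X.factor_carrier)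
  have "h a = a \<odot>\<^bsub>D\<^esub> \<psi> x" if a: "a \<in> J" for a
  proof -
    have aR: "a \<in> carrier R" using a J_cl(3) by auto
    have "K +>\<^bsub>X\<^esub> s a = K +>\<^bsub>X\<^esub> (a \<odot>\<^bsub>X\<^esub> x)" using e(2)[OF a] X.factor_smult[OF K aR x(1)] x(2) by simp
    then have "\<psi> (s a) = \<psi> (a \<odot>\<^bsub>X\<^esub> x)" using coset s(1)[OF a] aR x(1) by auto
    then show ?thesis using s(2)[OF a] p(3)[OF aR x(1)] by simp
  qed
  then show "\<exists>e\<in>carrier (D\<lparr>carrier := \<psi> ` carrier X\<rparr>).
      \<forall>a\<in>J. h a = a \<odot>\<^bsub>D\<lparr>carrier := \<psi> ` carrier X\<rparr>\<^esub> e"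
    using x(1) by auto
qed

text \<open>This is the induction step for finite sums. The sum need not be direct, so the element
  is found first modulo \<open>E\<close>, where the sum becomes an image of \<open>X\<close>, and
  then corrected inside \<open>E\<close>.\<close>

lemma baer_injective_add_cohereditary_image:
  assumes coh: "cohereditary R X" and D: "right_module R D" and psi: "\<psi> \<in> rmodule_hom R X D"
    and E: "submodule E R D" and baerE: "baer_injective R (D\<lparr>carrier := E\<rparr>)"
  shows "baer_injective R (D\<lparr>carrier := E <+>\<^bsub>D\<^esub> \<psi> ` carrier X\<rparr>)"
  unfolding baer_injective_def
proof (intro allI impI, elim conjE)
  fix J h
  let ?S = "E <+>\<^bsub>D\<^esub> \<psi> ` carrier X"
  assume J: "submodule J R (regular_rmodule R)"
    and h: "h \<in> rmodule_hom R (regular_rmodule R\<lparr>carrier := J\<rparr>) (D\<lparr>carrier := ?S\<rparr>)"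
  interpret X: right_module R X using coh by (simp add: cohereditary_def)
  interpret D: right_module R D by fact
  note p = rmodule_homD[OF psi] and E_cl = D.r_submoduleE[OF E]
  note reg = X.R.ring_axioms[THEN regular_right_module]
  have J_cl: "\<And>x y. \<lbrakk>x \<in> J; y \<in> J\<rbrakk> \<Longrightarrow> x \<oplus>\<^bsub>R\<^esub> y \<in> J"
    "\<And>a x. \<lbrakk>a \<in> carrier R; x \<in> J\<rbrakk> \<Longrightarrow> x \<otimes>\<^bsub>R\<^esub> a \<in> J" "J \<subseteq> carrier R"
    using right_module.r_submoduleE[OF reg J] by (auto simp: regular_rmodule_def)
  have h_add: "h (x \<oplus>\<^bsub>R\<^esub> y) = h x \<oplus>\<^bsub>D\<^esub> h y" if "x \<in> J" "y \<in> J" for x y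
    using rmodule_homD(2)[OF h] that by (simp add: regular_rmodule_def)
  have h_smult: "h (x \<otimes>\<^bsub>R\<^esub> a) = a \<odot>\<^bsub>D\<^esub> h x" if "a \<in> carrier R" "x \<in> J" for x a
    using rmodule_homD(3)[OF h] that by (simp add: regular_rmodule_def)
  have hS: "h a \<in> ?S" if "a \<in> J" for a
    using rmodule_homD(1)[OF h] that by simp
  have hD: "h a \<in> carrier D" if a: "a \<in> J" for a
  proof -
    obtain n x where "n \<in> E" "x \<in> carrier X" "h a = n \<oplus>\<^bsub>D\<^esub> \<psi> x"
      using hS[OF a] by (auto simp: set_add_def')
    then show ?thesis using p(1) E_cl(1) by (simp add: subset_iff)
  qed
  let ?F = "factor_rmodule D E"
  \<comment> \<open>The composite of \<open>\<psi>\<close> with the projection onto the factor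
    module; its image is the sum modulo \<open>E\<close>.\<close>
  let ?q = "\<lambda>x. E +>\<^bsub>D\<^esub> \<psi> x"
  interpret F: right_module R ?F by (rule D.factor_right_module[OF E])
  have q: "?q \<in> rmodule_hom R X ?F"
    using p D.factor_add[OF E] D.factor_smult[OF E]
    by (auto simp: rmodule_hom_def D.factor_carrier)
  have in_image: "E +>\<^bsub>D\<^esub> h a \<in> ?q ` carrier X" if a: "a \<in> J" for a
  proof -
    obtain n x where nx: "n \<in> E" "x \<in> carrier X" "h a = n \<oplus>\<^bsub>D\<^esub> \<psi> x"
      using hS[OF a] by (auto simp: set_add_def')
    have "h a \<ominus>\<^bsub>D\<^esub> \<psi> x = n"
      using nx p(1) E_cl(1) by (auto simp: a_minus_def D.M.a_assoc D.M.r_neg subset_iff)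
    then have "E +>\<^bsub>D\<^esub> h a = ?q x"
      using nx p(1) hD[OF a] by (simp add: D.coset_eq_iff[OF E])
    then show ?thesis using nx(2) by blast
  qed
  have "(\<lambda>a. E +>\<^bsub>D\<^esub> h a) \<in>
    rmodule_hom R (regular_rmodule R\<lparr>carrier := J\<rparr>) (?F\<lparr>carrier := ?q ` carrier X\<rparr>)"
    using in_image hD h_add h_smult D.factor_add[OF E] D.factor_smult[OF E]
    by (auto simp: rmodule_hom_def regular_rmodule_def)
  \<comment> \<open>Cohereditarity enters here, through \<open>?q\<close> rather than
    \<open>\<psi>\<close>; the element \<open>e\<close> obtained is the coset of some
    \<open>\<psi> x\<close>.\<close>
  from baer_injectiveD[OF cohereditary_image_baer_injective[OF coh F.right_module_axioms q] J this]
  obtain e where "e \<in> ?q ` carrier X" and e: "\<And>a. a \<in> J \<Longrightarrow> E +>\<^bsub>D\<^esub> h a = a \<odot>\<^bsub>?F\<^esub> e"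
    by auto
  then obtain x where x: "x \<in> carrier X" "e = ?q x" by auto
  \<comment> \<open>What is left of \<open>h\<close> after subtracting the part given by
    \<open>\<psi> x\<close>; it vanishes modulo \<open>E\<close>.\<close>
  define k where "k a = h a \<ominus>\<^bsub>D\<^esub> a \<odot>\<^bsub>D\<^esub> \<psi> x" for a
  have kE: "k a \<in> E" if a: "a \<in> J" for a
  proof -
    have aR: "a \<in> carrier R" using a J_cl(3) by auto
    have "E +>\<^bsub>D\<^esub> h a = E +>\<^bsub>D\<^esub> (a \<odot>\<^bsub>D\<^esub> \<psi> x)"
      using e[OF a] x p(1) D.factor_smult[OF E aR] by simp
    then show ?thesis
      unfolding k_def using D.coset_eq_iff[OF E hD[OF a]] aR x(1) p(1) by auto
  qed
  have "k \<in> rmodule_hom R (regular_rmodule R\<lparr>carrier := J\<rparr>) (D\<lparr>carrier := E\<rparr>)"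
  proof -
    have aR: "a \<in> carrier R" if "a \<in> J" for a using that J_cl(3) by auto
    note px = p(1)[OF x(1)]
    have "k (a \<oplus>\<^bsub>R\<^esub> b) = k a \<oplus>\<^bsub>D\<^esub> k b" if "a \<in> J" "b \<in> J" for a b
      unfolding k_def using that aR px hD
      by (simp add: h_add D.smult_l_distr D.add_diff_add)
    moreover have "k (b \<otimes>\<^bsub>R\<^esub> a) = a \<odot>\<^bsub>D\<^esub> k b" if "a \<in> carrier R" "b \<in> J" for a b
      unfolding k_def using that aR px hD
      by (simp add: h_smult D.smult_assoc D.smult_minus)
    ultimately show ?thesis using kE by (auto simp: rmodule_hom_def regular_rmodule_def)
  qed
  from baer_injectiveD[OF baerE J this]
  obtain n where n: "n \<in> E" and kn: "\<And>a. a \<in> J \<Longrightarrow> k a = a \<odot>\<^bsub>D\<^esub> n"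
    by auto
  have "h a = a \<odot>\<^bsub>D\<^esub> (n \<oplus>\<^bsub>D\<^esub> \<psi> x)" if a: "a \<in> J" for a
  proof -
    have aR: "a \<in> carrier R" using a J_cl(3) by auto
    have nD: "n \<in> carrier D" using n E_cl(1) by auto
    have "h a = k a \<oplus>\<^bsub>D\<^esub> a \<odot>\<^bsub>D\<^esub> \<psi> x"
      unfolding k_def using hD[OF a] aR p(1)[OF x(1)]
      by (simp add: a_minus_def D.M.a_assoc D.M.l_neg)
    then show ?thesis using kn[OF a] aR nD p(1)[OF x(1)] by (simp add: D.smult_r_distr)
  qed
  moreover have "n \<oplus>\<^bsub>D\<^esub> \<psi> x \<in> ?S" using n x(1) by (auto simp: set_add_def')
  ultimately show "\<exists>e\<in>carrier (D\<lparr>carrier := ?S\<rparr>). \<forall>a\<in>J. h a = a \<odot>\<^bsub>D\<lparr>carrier := ?S\<rparr>\<^esub> e"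
    by auto
qed

text \<open>
  The preimages in \<open>J\<close> of the members of the family form a directed family of right ideals with
  union \<open>J\<close>, so by the chain condition one of them is already \<open>J\<close>.
\<close>

lemma baer_injective_directed_Union:
  assumes noeth: "right_noetherian R" and D: "right_module R D"
    and ne: "\<C> \<noteq> {}"
    and sub: "\<And>E. E \<in> \<C> \<Longrightarrow> submodule E R D"
    and baer: "\<And>E. E \<in> \<C> \<Longrightarrow> baer_injective R (D\<lparr>carrier := E\<rparr>)"
    and directed: "\<And>E F. \<lbrakk>E \<in> \<C>; F \<in> \<C>\<rbrakk> \<Longrightarrow> \<exists>G\<in>\<C>. E \<union> F \<subseteq> G"
  shows "baer_injective R (D\<lparr>carrier := \<Union>\<C>\<rparr>)"
  unfolding baer_injective_def
proof (intro allI impI, elim conjE)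
  fix J h
  assume J: "submodule J R (regular_rmodule R)"
    and h: "h \<in> rmodule_hom R (regular_rmodule R\<lparr>carrier := J\<rparr>) (D\<lparr>carrier := \<Union>\<C>\<rparr>)"
  interpret D: right_module R D by fact
  interpret reg: right_module R "regular_rmodule R"
    by (rule regular_right_module[OF D.R.ring_axioms])
  note J_cl = reg.r_submoduleE[OF J]
  have h_hom: "h x \<in> \<Union>\<C>" "h (x \<oplus>\<^bsub>regular_rmodule R\<^esub> y) = h x \<oplus>\<^bsub>D\<^esub> h y"
    "a \<in> carrier R \<Longrightarrow> h (a \<odot>\<^bsub>regular_rmodule R\<^esub> x) = a \<odot>\<^bsub>D\<^esub> h x"
    if "x \<in> J" "y \<in> J" for x y a
    using rmodule_homD[OF h] that by auto
  have "\<Union>\<C> \<subseteq> carrier D" using D.r_submoduleE(1)[OF sub] by blast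
  \<comment> \<open>The target is enlarged to \<open>D\<close>, which is known to be a module, so
    that \<open>rmodule_hom_zero\<close> applies.\<close>
  then have h_D: "h \<in> rmodule_hom R (regular_rmodule R\<lparr>carrier := J\<rparr>) D"
    using h by (auto simp: rmodule_hom_def subset_iff Pi_iff)
  have zero: "h \<zero>\<^bsub>regular_rmodule R\<^esub> = \<zero>\<^bsub>D\<^esub>"
    using rmodule_hom_zero[OF reg.submodule_right_module[OF J] D h_D] by simp
  define P where "P E = {a \<in> J. h a \<in> E}" for E
  have P_sub: "submodule (P E) R (regular_rmodule R)" if "E \<in> \<C>" for E
    using J_cl D.r_submoduleE[OF sub[OF that]] zero h_hom(2,3)
    by (intro reg.r_submoduleI) (auto simp: P_def)
  have "\<exists>E\<in>\<C>. P E = J"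
  proof (rule ccontr)
    assume none: "\<not> (\<exists>E\<in>\<C>. P E = J)"
    \<comment> \<open>An element of \<open>J\<close> outside \<open>P E\<close> has its value in
      another member of the family; an upper bound of the two members has a strictly larger
      preimage.\<close>
    have step: "\<exists>F. F \<in> \<C> \<and> P E \<subset> P F" if E: "E \<in> \<C>" for E
    proof -
      have "P E \<subseteq> J" "P E \<noteq> J" using none E by (auto simp: P_def)
      then obtain a where a: "a \<in> J" "a \<notin> P E" by blast
      obtain G where G: "G \<in> \<C>" "h a \<in> G" using h_hom(1)[OF a(1) a(1)] by blast
      obtain F where F: "F \<in> \<C>" "E \<union> G \<subseteq> F" using directed[OF E G(1)] by blast
      have "P E \<subseteq> P F" "a \<in> P F" using F(2) G(2) a(1) by (auto simp: P_def)
      then show ?thesis using F(1) a(2) by blast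
    qed
    \<comment> \<open>Dependent choice turns this into a strictly ascending sequence of right
      ideals, against the chain condition.\<close>
    have "\<exists>c. \<forall>n::nat. c n \<in> \<C> \<and> P (c n) \<subset> P (c (Suc n))"
      by (rule dependent_nat_choice) (use ne step in auto)
    then obtain c where c: "\<And>n::nat. c n \<in> \<C>" "\<And>n. P (c n) \<subset> P (c (Suc n))" by blast
    have "\<exists>m. \<forall>n\<ge>m. P (c n) = P (c m)"
      by (rule noeth[unfolded right_noetherian_def, rule_format]) (use c P_sub in blast)
    then obtain m where "\<forall>n\<ge>m. P (c n) = P (c m)" by blast
    then have "P (c (Suc m)) = P (c m)" by (rule allE[of _ "Suc m"]) (erule mp, rule le_SucI, rule order_refl)
    then show False using c(2)[of m] by simp
  qed
  then obtain E where E: "E \<in> \<C>" "P E = J" by blast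
  \<comment> \<open>Since \<open>P E\<close> is all of \<open>J\<close>, every value of
    \<open>h\<close> lies in \<open>E\<close>.\<close>
  then have "h \<in> rmodule_hom R (regular_rmodule R\<lparr>carrier := J\<rparr>) (D\<lparr>carrier := E\<rparr>)"
    using h by (auto simp: rmodule_hom_def P_def)
  from baer_injectiveD[OF baer[OF E(1)] J this]
  obtain e where e: "e \<in> E" "\<And>a. a \<in> J \<Longrightarrow> h a = a \<odot>\<^bsub>D\<^esub> e" by auto
  then show "\<exists>e\<in>carrier (D\<lparr>carrier := \<Union>\<C>\<rparr>). \<forall>a\<in>J. h a = a \<odot>\<^bsub>D\<lparr>carrier := \<Union>\<C>\<rparr>\<^esub> e"
    using E(1) by auto
qed

section \<open>Sums and complements of submodules\<close>

lemma (in right_module) submodule_set_add: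
  assumes "submodule H R M" "submodule K R M"
  shows "submodule (H <+>\<^bsub>M\<^esub> K) R M" "H \<subseteq> H <+>\<^bsub>M\<^esub> K" "K \<subseteq> H <+>\<^bsub>M\<^esub> K"
proof -
  note H = r_submoduleE[OF assms(1)] and K = r_submoduleE[OF assms(2)]
  have mem: "x \<in> H <+>\<^bsub>M\<^esub> K \<longleftrightarrow> (\<exists>u\<in>H. \<exists>v\<in>K. x = u \<oplus>\<^bsub>M\<^esub> v)" for x
    by (auto simp: set_add_def')
  have c: "u \<in> carrier M" if "u \<in> H \<or> u \<in> K" for u using that H(1) K(1) by blast
  show "H \<subseteq> H <+>\<^bsub>M\<^esub> K"
  proof
    fix x assume "x \<in> H"
    then show "x \<in> H <+>\<^bsub>M\<^esub> K" using K(2) c[of x] by (force simp: mem)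
  qed
  moreover show "K \<subseteq> H <+>\<^bsub>M\<^esub> K"
  proof
    fix x assume "x \<in> K"
    then show "x \<in> H <+>\<^bsub>M\<^esub> K" using H(2) c[of x] by (force simp: mem)
  qed
  ultimately have zero: "\<zero>\<^bsub>M\<^esub> \<in> H <+>\<^bsub>M\<^esub> K" using H(2) by blast
  show "submodule (H <+>\<^bsub>M\<^esub> K) R M"
  proof (rule r_submoduleI)
    fix x y assume "x \<in> H <+>\<^bsub>M\<^esub> K" "y \<in> H <+>\<^bsub>M\<^esub> K"
    then obtain u v u' v' where *: "u \<in> H" "v \<in> K" "x = u \<oplus>\<^bsub>M\<^esub> v" "u' \<in> H" "v' \<in> K" "y = u' \<oplus>\<^bsub>M\<^esub> v'"
      by (auto simp: mem)
    then have "x \<oplus>\<^bsub>M\<^esub> y = (u \<oplus>\<^bsub>M\<^esub> u') \<oplus>\<^bsub>M\<^esub> (v \<oplus>\<^bsub>M\<^esub> v')" using c by (simp add: M.a_ac)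
    then show "x \<oplus>\<^bsub>M\<^esub> y \<in> H <+>\<^bsub>M\<^esub> K" using * H(3) K(3) unfolding mem by blast
  next
    fix a x assume "a \<in> carrier R" "x \<in> H <+>\<^bsub>M\<^esub> K"
    then show "a \<odot>\<^bsub>M\<^esub> x \<in> H <+>\<^bsub>M\<^esub> K"
      using H(6) K(6) c by (auto simp: mem) (metis smult_r_distr)
  qed (use c zero in \<open>auto simp: mem\<close>)
qed

text \<open>
  A submodule \<open>K\<close> maximal with \<open>I \<inter> K = 0\<close> is a complement: for \<open>d\<close> in \<open>D\<close>, the
  \<open>I\<close>-component of \<open>d a\<close> is defined on the right ideal of all \<open>a\<close> with
  \<open>d a \<in> I + K\<close> and equals \<open>e a\<close> for some \<open>e \<in> I\<close>. Then \<open>K + (d - e) A\<close> still meets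
  \<open>I\<close> trivially, so \<open>d - e \<in> K\<close>.
\<close>

lemma baer_injective_direct_summand:
  assumes D: "right_module R D" and I: "submodule I R D"
    and baer: "baer_injective R (D\<lparr>carrier := I\<rparr>)"
  shows "direct_summand R D I"
proof -
  interpret D: right_module R D by fact
  interpret reg: right_module R "regular_rmodule R"
    by (rule regular_right_module[OF D.R.ring_axioms])
  note I_cl = D.r_submoduleE[OF I]
  define \<A> where "\<A> = {K. submodule K R D \<and> I \<inter> K = {\<zero>\<^bsub>D\<^esub>}}"
  have "{\<zero>\<^bsub>D\<^esub>} \<in> \<A>"
    using I_cl(2) by (auto simp: \<A>_def D.smult_zero intro!: D.r_submoduleI)
  \<comment> \<open>\<open>subset_Zorn_nonempty\<close> asks for some member of \<open>\<A>\<close>,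
    here the zero submodule, and for the unions of non-empty chains.\<close>
  moreover have "\<Union>\<C> \<in> \<A>" if ne: "\<C> \<noteq> {}" and ch: "subset.chain \<A> \<C>" for \<C>
  proof -
    have mem: "submodule K R D" "I \<inter> K = {\<zero>\<^bsub>D\<^esub>}" if "K \<in> \<C>" for K
      using that ch by (auto simp: subset.chain_def \<A>_def)
    have cmp: "K \<subseteq> L \<or> L \<subseteq> K" if "K \<in> \<C>" "L \<in> \<C>" for K L
      using that ch by (auto simp: subset.chain_def)
    note K_cl = D.r_submoduleE[OF mem(1)]
    have "submodule (\<Union>\<C>) R D"
    proof (rule D.r_submoduleI)
      show "x \<oplus>\<^bsub>D\<^esub> y \<in> \<Union>\<C>" if xy: "x \<in> \<Union>\<C>" "y \<in> \<Union>\<C>" for x y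
      proof -
        obtain K L where KL: "K \<in> \<C>" "x \<in> K" "L \<in> \<C>" "y \<in> L" using xy by blast
        then obtain G where "G \<in> \<C>" "x \<in> G" "y \<in> G" using cmp[of K L] by blast
        then show ?thesis using K_cl(3)[of G x y] by blast
      qed
      show "a \<odot>\<^bsub>D\<^esub> x \<in> \<Union>\<C>" if "a \<in> carrier R" "x \<in> \<Union>\<C>" for a x
        using that(2) K_cl(6)[OF _ that(1)] by blast
      show "\<Union>\<C> \<subseteq> carrier D" using K_cl(1) by blast
      obtain K where "K \<in> \<C>" using ne by blast
      then show "\<zero>\<^bsub>D\<^esub> \<in> \<Union>\<C>" using K_cl(2)[of K] by blast
    qed
    moreover have "I \<inter> \<Union>\<C> = {\<zero>\<^bsub>D\<^esub>}" using ne mem(2) by blast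
    ultimately show ?thesis by (simp add: \<A>_def)
  qed
  ultimately have "\<exists>K\<in>\<A>. \<forall>L\<in>\<A>. K \<subseteq> L \<longrightarrow> L = K"
    by (intro subset_Zorn_nonempty) auto
  then obtain K where KA: "K \<in> \<A>" and max: "\<And>L. \<lbrakk>L \<in> \<A>; K \<subseteq> L\<rbrakk> \<Longrightarrow> L = K" by blast
  have K: "submodule K R D" and IK: "I \<inter> K = {\<zero>\<^bsub>D\<^esub>}" using KA by (auto simp: \<A>_def)
  note K_cl = D.r_submoduleE[OF K] and S = D.submodule_set_add[OF I K]
  let ?S = "I <+>\<^bsub>D\<^esub> K"
  note S_cl = D.r_submoduleE[OF S(1)]
  have "d \<in> ?S" if d: "d \<in> carrier D" for d
  proof -
    define J where "J = {a \<in> carrier R. a \<odot>\<^bsub>D\<^esub> d \<in> ?S}"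
    \<comment> \<open>The set \<open>J\<close> is the preimage of \<open>?S\<close> under this map,
      hence a right ideal.\<close>
    have mult_d: "(\<lambda>a. a \<odot>\<^bsub>D\<^esub> d) \<in> rmodule_hom R (regular_rmodule R) D"
      using d by (auto simp: rmodule_hom_def regular_rmodule_def D.smult_l_distr D.smult_assoc)
    have J: "submodule J R (regular_rmodule R)"
      using rmodule_hom_vimage_submodule[OF reg.right_module_axioms D mult_d S(1)]
      by (simp add: J_def regular_rmodule_def)
    have JR: "J \<subseteq> carrier R" by (auto simp: J_def)
    have "\<forall>a\<in>J. \<exists>u. u \<in> I \<and> a \<odot>\<^bsub>D\<^esub> d \<ominus>\<^bsub>D\<^esub> u \<in> K"
    proof
      fix a assume "a \<in> J"
      then obtain u v where "u \<in> I" "v \<in> K" "a \<odot>\<^bsub>D\<^esub> d = u \<oplus>\<^bsub>D\<^esub> v"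
        by (auto simp: J_def set_add_def')
      moreover from this have "a \<odot>\<^bsub>D\<^esub> d \<ominus>\<^bsub>D\<^esub> u = v"
        using I_cl(1) K_cl(1) by (simp add: subset_iff D.add_diff_cancel_left)
      ultimately show "\<exists>u. u \<in> I \<and> a \<odot>\<^bsub>D\<^esub> d \<ominus>\<^bsub>D\<^esub> u \<in> K" by auto
    qed
    then obtain h where h: "\<And>a. a \<in> J \<Longrightarrow> h a \<in> I" "\<And>a. a \<in> J \<Longrightarrow> a \<odot>\<^bsub>D\<^esub> d \<ominus>\<^bsub>D\<^esub> h a \<in> K"
      by metis
    \<comment> \<open>Two candidates for the \<open>I\<close>-component of \<open>d a\<close> differ
      by an element of both \<open>I\<close> and \<open>K\<close>, hence agree. Linearity of the
      chosen \<open>h\<close> follows, since sums and multiples of components are again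
      candidates.\<close>
    have uniq: "h a = u" if a: "a \<in> J" and u: "u \<in> I" "a \<odot>\<^bsub>D\<^esub> d \<ominus>\<^bsub>D\<^esub> u \<in> K" for a u
    proof -
      have c: "a \<odot>\<^bsub>D\<^esub> d \<in> carrier D" "h a \<in> carrier D" "u \<in> carrier D"
        using a u h(1) I_cl(1) JR d by auto
      have "(a \<odot>\<^bsub>D\<^esub> d \<ominus>\<^bsub>D\<^esub> u) \<ominus>\<^bsub>D\<^esub> (a \<odot>\<^bsub>D\<^esub> d \<ominus>\<^bsub>D\<^esub> h a) = h a \<ominus>\<^bsub>D\<^esub> u"
        using c by (simp add: D.diff_diff_diff)
      then have "h a \<ominus>\<^bsub>D\<^esub> u \<in> I \<inter> K"
        using K_cl(5)[OF u(2) h(2)[OF a]] I_cl(5)[OF h(1)[OF a] u(1)] by simp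
      then show ?thesis using IK c D.diff_eq_zero_iff by auto
    qed
    have J_cl: "x \<oplus>\<^bsub>R\<^esub> y \<in> J" "a \<in> carrier R \<Longrightarrow> x \<otimes>\<^bsub>R\<^esub> a \<in> J"
      if "x \<in> J" "y \<in> J" for x y a
      using that reg.r_submoduleE[OF J] by (auto simp: regular_rmodule_def)
    have "h \<in> rmodule_hom R (regular_rmodule R\<lparr>carrier := J\<rparr>) (D\<lparr>carrier := I\<rparr>)"
    proof -
      have "h (x \<oplus>\<^bsub>R\<^esub> y) = h x \<oplus>\<^bsub>D\<^esub> h y" if xy: "x \<in> J" "y \<in> J" for x y
      proof (rule uniq)
        have "(x \<oplus>\<^bsub>R\<^esub> y) \<odot>\<^bsub>D\<^esub> d \<ominus>\<^bsub>D\<^esub> (h x \<oplus>\<^bsub>D\<^esub> h y) =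
            (x \<odot>\<^bsub>D\<^esub> d \<ominus>\<^bsub>D\<^esub> h x) \<oplus>\<^bsub>D\<^esub> (y \<odot>\<^bsub>D\<^esub> d \<ominus>\<^bsub>D\<^esub> h y)"
          using xy JR d h(1) I_cl(1) by (simp add: D.smult_l_distr D.add_diff_add subset_iff)
        then show "(x \<oplus>\<^bsub>R\<^esub> y) \<odot>\<^bsub>D\<^esub> d \<ominus>\<^bsub>D\<^esub> (h x \<oplus>\<^bsub>D\<^esub> h y) \<in> K"
          using h(2) xy K_cl(3) by simp
      qed (use xy J_cl h(1) I_cl(3) in auto)
      moreover have "h (x \<otimes>\<^bsub>R\<^esub> a) = a \<odot>\<^bsub>D\<^esub> h x" if a: "a \<in> carrier R" and x: "x \<in> J" for a x
      proof (rule uniq)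
        have "(x \<otimes>\<^bsub>R\<^esub> a) \<odot>\<^bsub>D\<^esub> d \<ominus>\<^bsub>D\<^esub> a \<odot>\<^bsub>D\<^esub> h x = a \<odot>\<^bsub>D\<^esub> (x \<odot>\<^bsub>D\<^esub> d \<ominus>\<^bsub>D\<^esub> h x)"
          using a x JR d h(1) I_cl(1) by (simp add: D.smult_assoc D.smult_minus subset_iff)
        then show "(x \<otimes>\<^bsub>R\<^esub> a) \<odot>\<^bsub>D\<^esub> d \<ominus>\<^bsub>D\<^esub> a \<odot>\<^bsub>D\<^esub> h x \<in> K"
          using h(2) a x K_cl(6) by simp
      qed (use a x J_cl h(1) I_cl(6) in auto)
      ultimately show ?thesis using h(1) by (auto simp: rmodule_hom_def regular_rmodule_def)
    qed
    from baer_injectiveD[OF baer J this]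
    obtain e where e: "e \<in> I" "\<And>a. a \<in> J \<Longrightarrow> h a = a \<odot>\<^bsub>D\<^esub> e" by auto
    have eD: "e \<in> carrier D" using e(1) I_cl(1) by auto
    define d' where "d' = d \<ominus>\<^bsub>D\<^esub> e"
    have d': "d' \<in> carrier D" using d eD by (simp add: d'_def)
    define C where "C = (\<lambda>a. a \<odot>\<^bsub>D\<^esub> d') ` carrier R"
    have mult_d': "(\<lambda>a. a \<odot>\<^bsub>D\<^esub> d') \<in> rmodule_hom R (regular_rmodule R) D"
      using d' by (auto simp: rmodule_hom_def regular_rmodule_def D.smult_l_distr D.smult_assoc)
    have "submodule (carrier R) R (regular_rmodule R)"
      by (rule reg.r_submoduleI) (auto simp: regular_rmodule_def)
    then have C: "submodule C R D"
      unfolding C_def by (rule rmodule_hom_image_submodule[OF reg.right_module_axioms D mult_d'])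
    note KC = D.submodule_set_add[OF K C]
    have "I \<inter> (K <+>\<^bsub>D\<^esub> C) \<subseteq> {\<zero>\<^bsub>D\<^esub>}"
    proof
      fix x assume x: "x \<in> I \<inter> (K <+>\<^bsub>D\<^esub> C)"
      then obtain k a where k: "k \<in> K" and a: "a \<in> carrier R" and xk: "x = k \<oplus>\<^bsub>D\<^esub> a \<odot>\<^bsub>D\<^esub> d'"
        by (auto simp: set_add_def' C_def)
      have kD: "k \<in> carrier D" and xD: "x \<in> carrier D" using k x K_cl(1) I_cl(1) by auto
      have ad': "a \<odot>\<^bsub>D\<^esub> d' = a \<odot>\<^bsub>D\<^esub> d \<ominus>\<^bsub>D\<^esub> a \<odot>\<^bsub>D\<^esub> e"
        unfolding d'_def using a d eD by (rule D.smult_minus)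
      \<comment> \<open>Solving \<open>x = k + d' a\<close> with \<open>d' = d - e\<close> for
        \<open>d a\<close> gives \<open>(x + e a) - k\<close>, an element of \<open>I + K\<close>,
        so \<open>a\<close> lies in \<open>J\<close>.\<close>
      have "a \<odot>\<^bsub>D\<^esub> d = (x \<oplus>\<^bsub>D\<^esub> a \<odot>\<^bsub>D\<^esub> e) \<oplus>\<^bsub>D\<^esub> (\<ominus>\<^bsub>D\<^esub> k)"
        unfolding xk using a d' d eD kD D.add_diff_cancel_left[of k "a \<odot>\<^bsub>D\<^esub> d"]
          D.diff_add_cancel[of "a \<odot>\<^bsub>D\<^esub> d" "a \<odot>\<^bsub>D\<^esub> e"]
        by (simp add: D.M.a_assoc ad' flip: a_minus_def)
      moreover have "x \<oplus>\<^bsub>D\<^esub> a \<odot>\<^bsub>D\<^esub> e \<in> I" "\<ominus>\<^bsub>D\<^esub> k \<in> K"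
        using x k a e(1) I_cl(3,6) K_cl(4) by auto
      ultimately have aJ: "a \<in> J" using a unfolding J_def set_add_def' by blast
      \<comment> \<open>On \<open>J\<close> the product \<open>e a\<close> is the
        \<open>I\<close>-component \<open>h a\<close>, so what remains of \<open>d a\<close> lies in
        \<open>K\<close>.\<close>
      have "a \<odot>\<^bsub>D\<^esub> d' \<in> K" using h(2)[OF aJ] e(2)[OF aJ] ad' by simp
      then have "x \<in> K" using xk k K_cl(3) by simp
      then show "x \<in> {\<zero>\<^bsub>D\<^esub>}" using x IK by auto
    qed
    moreover have "\<zero>\<^bsub>D\<^esub> \<in> I \<inter> (K <+>\<^bsub>D\<^esub> C)" using I_cl(2) K_cl(2) KC(2) by auto
    ultimately have "K <+>\<^bsub>D\<^esub> C \<in> \<A>" using KC(1) by (auto simp: \<A>_def)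
    then have "K <+>\<^bsub>D\<^esub> C = K" using max KC(2) by blast
    moreover have "d' \<in> C"
      unfolding C_def using d' by (intro image_eqI[of _ _ "\<one>\<^bsub>R\<^esub>"]) auto
    ultimately have "d' \<in> K" using KC(3) by auto
    moreover have "d = e \<oplus>\<^bsub>D\<^esub> d'"
      using D.diff_add_cancel[OF d eD] D.M.a_comm[OF eD d'] by (simp add: d'_def)
    ultimately show ?thesis using e(1) by (auto simp: set_add_def')
  qed
  then have "?S = carrier D" using S_cl(1) by blast
  then show ?thesis using I K IK unfolding direct_summand_def by blast
qed

section \<open>Images of direct powers\<close>

text \<open>Elements of the direct power have finite support, so the image is the union of the
  images of the finite subpowers. These are built up from zero, one coordinate at a time.\<close>

lemma direct_power_image_baer_injective:
  fixes X :: "('a, 'b, 'm) module_scheme" and \<Lambda> :: "'i set"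
  defines "D \<equiv> direct_power X \<Lambda>"
  assumes coh: "cohereditary R X" and noeth: "right_noetherian R"
    and N: "right_module R N" and phi: "\<phi> \<in> rmodule_hom R D N"
  shows "baer_injective R (N\<lparr>carrier := \<phi> ` carrier D\<rparr>)"
proof -
  interpret X: right_module R X using coh by (simp add: cohereditary_def)
  interpret N: right_module R N by fact
  interpret D: right_module R D unfolding D_def by (rule X.direct_power_right_module)
  note p = rmodule_homD[OF phi]
  have D_iff: "f \<in> carrier D \<longleftrightarrow> f \<in> \<Lambda> \<rightarrow>\<^sub>E carrier X \<and> finite {i \<in> \<Lambda>. f i \<noteq> \<zero>\<^bsub>X\<^esub>}" for f
    by (simp add: D_def direct_power_def)
  have D_zero: "\<zero>\<^bsub>D\<^esub> = (\<lambda>i\<in>\<Lambda>. \<zero>\<^bsub>X\<^esub>)" by (simp add: D_def direct_power_def)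
  have D_add: "f \<oplus>\<^bsub>D\<^esub> g = (\<lambda>i\<in>\<Lambda>. f i \<oplus>\<^bsub>X\<^esub> g i)" for f g by (simp add: D_def direct_power_def)
  have D_smult: "a \<odot>\<^bsub>D\<^esub> f = (\<lambda>i\<in>\<Lambda>. a \<odot>\<^bsub>X\<^esub> f i)" for a f by (simp add: D_def direct_power_def)
  \<comment> \<open>The subpower indexed by \<open>F\<close>, kept inside \<open>D\<close> as the
    functions vanishing off \<open>F\<close>.\<close>
  define P where "P F = {f \<in> carrier D. \<forall>i\<in>\<Lambda> - F. f i = \<zero>\<^bsub>X\<^esub>}" for F
  have P_sub: "submodule (P F) R D" for F
  proof (rule D.r_submoduleI)
    show "f \<oplus>\<^bsub>D\<^esub> g \<in> P F" if "f \<in> P F" "g \<in> P F" for f g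
      using that D.M.a_closed[of f g] by (auto simp: P_def D_add)
    show "a \<odot>\<^bsub>D\<^esub> f \<in> P F" if "a \<in> carrier R" "f \<in> P F" for a f
      using that D.smult_closed[of a f] X.smult_zero by (auto simp: P_def D_smult)
    show "\<zero>\<^bsub>D\<^esub> \<in> P F" using D.M.zero_closed by (auto simp: P_def D_zero)
  qed (auto simp: P_def)
  define S where "S F = \<phi> ` P F" for F
  have S_sub: "submodule (S F) R N" for F
    unfolding S_def by (rule rmodule_hom_image_submodule[OF D.right_module_axioms N phi P_sub])
  \<comment> \<open>The embedding of \<open>X\<close> as coordinate \<open>i\<close>.\<close>
  define \<iota> where "\<iota> i x = (\<lambda>j\<in>\<Lambda>. if j = i then x else \<zero>\<^bsub>X\<^esub>)" for i x
  have iota_cl: "\<iota> i x \<in> carrier D" if "x \<in> carrier X" for i x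
  proof -
    have "{j \<in> \<Lambda>. \<iota> i x j \<noteq> \<zero>\<^bsub>X\<^esub>} \<subseteq> {i}" by (auto simp: \<iota>_def)
    then have "finite {j \<in> \<Lambda>. \<iota> i x j \<noteq> \<zero>\<^bsub>X\<^esub>}" by (rule finite_subset) simp
    then show ?thesis using that by (auto simp: D_iff \<iota>_def)
  qed
  have iota: "\<iota> i \<in> rmodule_hom R X D" for i
    unfolding rmodule_hom_def
    using iota_cl X.smult_zero by (auto simp: \<iota>_def D_add D_smult intro!: restrict_ext)
  have phi_iota: "\<phi> \<circ> \<iota> i \<in> rmodule_hom R X N" for i
    using rmodule_homD[OF iota] p by (auto simp: rmodule_hom_def)
  have S_insert: "S (insert i F) = S F <+>\<^bsub>N\<^esub> (\<phi> \<circ> \<iota> i) ` carrier X"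
    if i: "i \<in> \<Lambda>" "i \<notin> F" for i F
  proof
    show "S (insert i F) \<subseteq> S F <+>\<^bsub>N\<^esub> (\<phi> \<circ> \<iota> i) ` carrier X"
    proof
      fix y assume "y \<in> S (insert i F)"
      then obtain f where f: "f \<in> P (insert i F)" "y = \<phi> f" by (auto simp: S_def)
      \<comment> \<open>This is \<open>f\<close> with coordinate \<open>i\<close> replaced by zero;
        the part removed is \<open>\<iota> i (f i)\<close>.\<close>
      define g where "g = (\<lambda>j\<in>\<Lambda>. if j = i then \<zero>\<^bsub>X\<^esub> else f j)"
      have fX: "f j \<in> carrier X" if "j \<in> \<Lambda>" for j using f(1) that by (auto simp: P_def D_iff)
      have "finite {j \<in> \<Lambda>. g j \<noteq> \<zero>\<^bsub>X\<^esub>}"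
        by (rule finite_subset[of _ "{j \<in> \<Lambda>. f j \<noteq> \<zero>\<^bsub>X\<^esub>}"])
          (use f(1) in \<open>auto simp: g_def P_def D_iff\<close>)
      then have g: "g \<in> P F" using f(1) fX by (auto simp: g_def P_def D_iff)
      have "f = g \<oplus>\<^bsub>D\<^esub> \<iota> i (f i)"
      proof
        \<comment> \<open>The index \<open>j\<close> ranges over the whole type; outside
          \<open>\<Lambda>\<close> both functions take the value \<open>undefined\<close>.\<close>
        fix j
        show "f j = (g \<oplus>\<^bsub>D\<^esub> \<iota> i (f i)) j"
          using f(1) fX by (auto simp: g_def \<iota>_def D_add P_def D_iff PiE_def extensional_def)
      qed
      then have "y = \<phi> g \<oplus>\<^bsub>N\<^esub> (\<phi> \<circ> \<iota> i) (f i)"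
        using f(2) p(2)[of g "\<iota> i (f i)"] g iota_cl fX i(1) by (simp add: P_def)
      moreover have "\<phi> g \<in> S F" using g by (simp add: S_def)
      ultimately show "y \<in> S F <+>\<^bsub>N\<^esub> (\<phi> \<circ> \<iota> i) ` carrier X"
        using fX[OF i(1)] unfolding set_add_def' by blast
    qed
    have "P F \<subseteq> P (insert i F)" by (auto simp: P_def)
    moreover have "\<iota> i x \<in> P (insert i F)" if "x \<in> carrier X" for x
      using iota_cl[OF that] by (auto simp: P_def \<iota>_def)
    ultimately have "S F \<subseteq> S (insert i F)" "(\<phi> \<circ> \<iota> i) ` carrier X \<subseteq> S (insert i F)"
      by (auto simp: S_def)
    then show "S F <+>\<^bsub>N\<^esub> (\<phi> \<circ> \<iota> i) ` carrier X \<subseteq> S (insert i F)"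
      using N.r_submoduleE(3)[OF S_sub] unfolding set_add_def' by blast
  qed
  have S_baer: "baer_injective R (N\<lparr>carrier := S F\<rparr>)" if "finite F" "F \<subseteq> \<Lambda>" for F
    using that
  proof (induction F rule: finite_induct)
    case empty
    \<comment> \<open>Only the zero function has empty support, so \<open>S {}\<close> is the zero
      submodule, and zero serves as the element in Baer's condition.\<close>
    have "f = \<zero>\<^bsub>D\<^esub>" if "f \<in> P {}" for f
      using that by (auto simp: P_def D_iff D_zero PiE_def extensional_def)
    then have "S {} \<subseteq> {\<zero>\<^bsub>N\<^esub>}"
      using rmodule_hom_zero[OF D.right_module_axioms N phi] by (auto simp: S_def)
    then have S0: "S {} = {\<zero>\<^bsub>N\<^esub>}" using N.r_submoduleE(2)[OF S_sub] by blast
    show ?case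
      unfolding baer_injective_def
    proof (intro allI impI, elim conjE)
      fix J h
      assume J: "submodule J R (regular_rmodule R)"
        and h: "h \<in> rmodule_hom R (regular_rmodule R\<lparr>carrier := J\<rparr>) (N\<lparr>carrier := S {}\<rparr>)"
      have "J \<subseteq> carrier R"
        using right_module.r_submoduleE(1)[OF regular_right_module[OF X.R.ring_axioms] J]
        by (simp add: regular_rmodule_def)
      then show "\<exists>e\<in>carrier (N\<lparr>carrier := S {}\<rparr>). \<forall>a\<in>J. h a = a \<odot>\<^bsub>N\<lparr>carrier := S {}\<rparr>\<^esub> e"
        using rmodule_homD(1)[OF h] by (auto simp: S0 N.smult_zero subset_iff)
    qed
  next
    case (insert i F)
    then show ?case
      using baer_injective_add_cohereditary_image[OF coh N phi_iota S_sub] S_insert by simp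
  qed
  let ?C = "S ` {F. finite F \<and> F \<subseteq> \<Lambda>}"
  have "baer_injective R (N\<lparr>carrier := \<Union>?C\<rparr>)"
  proof (rule baer_injective_directed_Union[OF noeth N])
    fix E E' assume "E \<in> ?C" "E' \<in> ?C"
    then obtain F F' where F: "E = S F" "E' = S F'" "finite (F \<union> F')" "F \<union> F' \<subseteq> \<Lambda>" by auto
    \<comment> \<open>The family is directed because \<open>P\<close> is monotone in its index
      set.\<close>
    have "S F \<union> S F' \<subseteq> S (F \<union> F')" by (auto simp: S_def P_def)
    then show "\<exists>G\<in>?C. E \<union> E' \<subseteq> G" using F by blast
  qed (use S_sub S_baer in auto)
  moreover have "\<Union>?C = \<phi> ` carrier D"
  proof
    show "\<phi> ` carrier D \<subseteq> \<Union>?C"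
    proof
      fix y assume "y \<in> \<phi> ` carrier D"
      then obtain f where f: "f \<in> carrier D" "y = \<phi> f" by blast
      \<comment> \<open>The support of \<open>f\<close> is the finite index set required.\<close>
      then have "f \<in> P {i \<in> \<Lambda>. f i \<noteq> \<zero>\<^bsub>X\<^esub>}" by (auto simp: P_def)
      then have "y \<in> S {i \<in> \<Lambda>. f i \<noteq> \<zero>\<^bsub>X\<^esub>}" using f(2) by (simp add: S_def)
      moreover have "finite {i \<in> \<Lambda>. f i \<noteq> \<zero>\<^bsub>X\<^esub>}" using f(1) by (simp add: D_iff)
      ultimately show "y \<in> \<Union>?C" by blast
    qed
  qed (auto simp: S_def P_def)
  ultimately show ?thesis by simp
qed

theorem proposition3p5:
  fixes A :: "('a, 'r) ring_scheme"
    and X :: "('a, 'b, 'm) module_scheme"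
  assumes "ring A"
    and "right_noetherian A"
    and "right_module A X"
    and "cohereditary A X"
  shows "Sigma_d_Rickart TYPE('i) A X"
  unfolding Sigma_d_Rickart_def
proof (intro conjI allI impI)
  fix \<Lambda> :: "'i set"
  let ?D = "direct_power X \<Lambda>"
  interpret X: right_module A X by fact
  interpret D: right_module A ?D by (rule X.direct_power_right_module)
  \<comment> \<open>The whole module counts as a submodule of itself, so that
    \<open>rmodule_hom_image_submodule\<close> covers images of endomorphisms.\<close>
  have top: "submodule (carrier ?D) A ?D" by (rule D.r_submoduleI) auto
  have "direct_summand A ?D (\<phi> ` carrier ?D)" if phi: "\<phi> \<in> rmodule_hom A ?D ?D" for \<phi>
  proof (rule baer_injective_direct_summand[OF D.right_module_axioms])
    show "submodule (\<phi> ` carrier ?D) A ?D"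
      by (rule rmodule_hom_image_submodule[OF D.right_module_axioms D.right_module_axioms phi top])
    show "baer_injective A (?D\<lparr>carrier := \<phi> ` carrier ?D\<rparr>)"
      by (rule direct_power_image_baer_injective[OF assms(4,2) D.right_module_axioms phi])
  qed
  then show "d_Rickart A ?D"
    using D.right_module_axioms by (simp add: d_Rickart_def)
qed fact

end
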